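(* Let $R$ be an order in $K$. The following algorithm is correct, i.e. it returns a list $\mathcal{L}^{iso}$ containing exactly one representative of each class in $\mathrm{ICM}(R)$. Compute the list $\mathcal{L}^o$ of all over-orders of $R$ and start with an empty list $\mathcal{L}^{iso}$. For each $S$ in $\mathcal{L}^o$, compute a list $\mathcal{L}^w_S$ of representatives of the classes of $\mathcal{W}_S(R)$ (one for each class) and a list $\mathcal{L}^i_S$ of representatives of the classes of $\mathrm{Pic}(S)$ (one for each class), and for each $I$ in $\mathcal{L}^w_S$ and each $J$ in $\mathcal{L}^i_S$ append $IJ$ to $\mathcal{L}^{iso}$. Return $\mathcal{L}^{iso}$.
   Context: An order is a commutative reduced ring $R$ with unit that is free and finitely generated as a $\mathbb{Z}$-module; its total quotient ring $K$ is a finite product of number fields, and $R$ is called an order in $K$. A fractional $R$-ideal is a finitely generated sub-$R$-module $I$ of $K$ with $I\otimes_{\mathbb Z}\mathbb{Q}=K$; $(I:J)=\{x\in K:xJ\subseteq I\}$, and $(I:I)$ is the multiplicator ring of $I$. An over-order of $R$ is a fractional $R$-ideal that is a subring of $K$ (so it contains $R$); there are finitely many. $\mathrm{ICM}(R)$ is the monoid of $R$-module isomorphism classes of fractional $R$-ideals ($I\simeq J$ iff $I=\alpha J$ for some $\alpha\in K^\times$). A fractional $S$-ideal $L$ is invertible if $LL'=S$ for some fractional $S$-ideal $L'$; $\mathrm{Pic}(S)$ is the group of isomorphism classes of invertible fractional $S$-ideals. Two fractional $R$-ideals $I,J$ are weakly equivalent if they satisfy the following equivalent conditions: $I_{\mathfrak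 p}\simeq J_{\mathfrak p}$ as $R_{\mathfrak p}$-modules for every maximal ideal $\mathfrak p$ of $R$; $1\in (I:J)(J:I)$; $I$ and $J$ have the same multiplicator ring $S$ and $I=LJ$ for some invertible fractional $S$-ideal $L$. $\mathcal{W}_S(R)$ is the set of weak equivalence classes of fractional $R$-ideals $I$ with $(I:I)=S$. *)

theory Defs
  imports Complex_Main
begin

text \<open>
  The total quotient ring \<open>K\<close> is the type \<open>'k\<close>; orders, over-orders and fractional ideals are
  subsets of it. All scalars of modules range over such a subset, so the type-based module theory
  of the library is available for \<open>\<int>\<close>-modules only.
\<close>

global_interpretation int_module: module "\<lambda>(n::int) (x::'k::comm_ring_1). of_int n * x"
  by unfold_locales (simp_all add: algebra_simps)

definition is_subring :: "'k::comm_ring_1 set \<Rightarrow> bool" where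
  "is_subring S \<longleftrightarrow> 1 \<in> S \<and> (\<forall>x\<in>S. \<forall>y\<in>S. x - y \<in> S \<and> x * y \<in> S)"

definition nonzerodivisor_in :: "'k::comm_ring_1 set \<Rightarrow> 'k \<Rightarrow> bool" where
  "nonzerodivisor_in R s \<longleftrightarrow> s \<in> R \<and> (\<forall>x\<in>R. s * x = 0 \<longrightarrow> x = 0)"

text \<open>\<open>'k\<close> is the localization of \<open>R\<close> at its non-zero-divisors (\<open>s dvd 1\<close>: \<open>s\<close> is a unit of \<open>'k\<close>).\<close>

definition UNIV_is_total_quotient_ring :: "'k::comm_ring_1 set \<Rightarrow> bool" where
  "UNIV_is_total_quotient_ring R \<longleftrightarrow>
     (\<forall>s. nonzerodivisor_in R s \<longrightarrow> s dvd 1) \<and>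
     (\<forall>x. \<exists>a\<in>R. \<exists>s. nonzerodivisor_in R s \<and> s * x = a)"

definition is_order :: "'k::comm_ring_1 set \<Rightarrow> bool" where
  "is_order R \<longleftrightarrow>
     is_subring R \<and>
     (\<forall>x\<in>R. \<forall>n::nat. x ^ n = 0 \<longrightarrow> x = 0) \<and>
     (\<exists>B. finite B \<and> int_module.independent B \<and> int_module.span B = R) \<and>
     UNIV_is_total_quotient_ring R"

definition is_submodule :: "'k::comm_ring_1 set \<Rightarrow> 'k set \<Rightarrow> bool" where
  "is_submodule R I \<longleftrightarrow>
     0 \<in> I \<and> (\<forall>x\<in>I. \<forall>y\<in>I. x + y \<in> I) \<and> (\<forall>r\<in>R. \<forall>x\<in>I. r * x \<in> I)"

definition finitely_generated :: "'k::comm_ring_1 set \<Rightarrow> 'k set \<Rightarrow> bool" where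
  "finitely_generated R I \<longleftrightarrow>
     (\<exists>G. finite G \<and> I = {\<Sum>g\<in>G. c g * g | c. \<forall>g\<in>G. c g \<in> R})"

text \<open>
  The last conjunct is \<open>I \<otimes> \<rat> = K\<close>: the elements of \<open>I \<otimes> \<rat>\<close> are the fractions \<open>y / n\<close> with
  \<open>y \<in> I\<close> and \<open>n\<close> a nonzero integer.
\<close>

definition fractional_ideal :: "'k::comm_ring_1 set \<Rightarrow> 'k set \<Rightarrow> bool" where
  "fractional_ideal R I \<longleftrightarrow>
     is_submodule R I \<and> finitely_generated R I \<and>
     (\<forall>x. \<exists>n::int. n \<noteq> 0 \<and> of_int n * x \<in> I)"

definition colon :: "'k::comm_ring_1 set \<Rightarrow> 'k set \<Rightarrow> 'k set" where
  "colon I J = {x. \<forall>y\<in>J. x * y \<in> I}"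

definition ideal_prod :: "'k::comm_ring_1 set \<Rightarrow> 'k set \<Rightarrow> 'k set" where
  "ideal_prod I J = {\<Sum>i<n. a i * b i | (n::nat) a b. \<forall>i<n. a i \<in> I \<and> b i \<in> J}"

definition over_orders :: "'k::comm_ring_1 set \<Rightarrow> 'k set set" where
  "over_orders R = {S. fractional_ideal R S \<and> is_subring S}"

definition module_iso :: "'k::comm_ring_1 set \<Rightarrow> 'k set \<Rightarrow> 'k set \<Rightarrow> bool" where
  "module_iso R I J \<longleftrightarrow>
     (\<exists>f. bij_betw f I J \<and>
          (\<forall>x\<in>I. \<forall>y\<in>I. f (x + y) = f x + f y) \<and>
          (\<forall>r\<in>R. \<forall>x\<in>I. f (r * x) = r * f x))"

definition invertible_ideal :: "'k::comm_ring_1 set \<Rightarrow> 'k set \<Rightarrow> bool" where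
  "invertible_ideal S L \<longleftrightarrow>
     fractional_ideal S L \<and> (\<exists>L'. fractional_ideal S L' \<and> ideal_prod L L' = S)"

definition weakly_equivalent :: "'k::comm_ring_1 set \<Rightarrow> 'k set \<Rightarrow> bool" where
  "weakly_equivalent I J \<longleftrightarrow> 1 \<in> ideal_prod (colon I J) (colon J I)"

definition classes :: "('a \<Rightarrow> 'a \<Rightarrow> bool) \<Rightarrow> 'a set \<Rightarrow> 'a set set" where
  "classes r A = A // {(x, y). x \<in> A \<and> y \<in> A \<and> r x y}"

text \<open>Only the underlying sets of the monoid \<open>ICM(R)\<close> and of the group \<open>Pic(S)\<close> are needed.\<close>

definition ICM :: "'k::comm_ring_1 set \<Rightarrow> 'k set set set" where
  "ICM R = classes (module_iso R) {I. fractional_ideal R I}"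

definition Pic :: "'k::comm_ring_1 set \<Rightarrow> 'k set set set" where
  "Pic S = classes (module_iso S) {L. invertible_ideal S L}"

definition weak_classes :: "'k::comm_ring_1 set \<Rightarrow> 'k set \<Rightarrow> 'k set set set" where
  "weak_classes R S = classes weakly_equivalent {I. fractional_ideal R I \<and> colon I I = S}"

text \<open>Representatives are counted by list positions, so repeated entries are excluded too.\<close>

definition lists_representatives :: "'a list \<Rightarrow> 'a set set \<Rightarrow> bool" where
  "lists_representatives xs Q \<longleftrightarrow>
     set xs \<subseteq> \<Union>Q \<and> (\<forall>C\<in>Q. \<exists>!i. i < length xs \<and> xs ! i \<in> C)"

text \<open>
  \<open>Lo\<close>, \<open>Lw S\<close> and \<open>Li S\<close> are the results of the computations of the over-orders of \<open>R\<close>, of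
  representatives of \<open>weak_classes R S\<close> and of representatives of \<open>Pic S\<close>.
\<close>

definition icm_algorithm ::
  "'k::comm_ring_1 set list \<Rightarrow> ('k set \<Rightarrow> 'k set list) \<Rightarrow> ('k set \<Rightarrow> 'k set list) \<Rightarrow> 'k set list"
where
  "icm_algorithm Lo Lw Li = [ideal_prod I J. S \<leftarrow> Lo, I \<leftarrow> Lw S, J \<leftarrow> Li S]"

end

theory Submission
  imports Defs
begin

text \<open>
  For a weak equivalence \<open>1 \<in> (I : W)(W : I)\<close> of ideals with multiplicator ring \<open>S\<close>, the colon ideal
  \<open>(I : W)\<close> is an invertible \<open>S\<close>-ideal with \<open>I = (I : W) W\<close>, so every class is reached.
  Conversely \<open>W J\<close> determines \<open>S\<close> as its multiplicator ring, then the weak class of \<open>W\<close>, and finally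
  the class of \<open>J\<close>: if \<open>W J\<^sub>1 = W J\<^sub>2\<close> then \<open>J\<^sub>1 J\<^sub>2\<inverse>\<close> and its inverse both lie in \<open>(W : W) = S\<close>.
  Finiteness conditions are handled over \<open>\<int>\<close>, where they do not depend on the order.
\<close>

section \<open>Products and colons of sets\<close>

lemma zero_in_ideal_prod: "0 \<in> ideal_prod I J"
  unfolding ideal_prod_def by (rule CollectI, rule exI[of _ 0]) simp

lemma mult_in_ideal_prod:
  assumes "a \<in> I" "b \<in> J"
  shows "a * b \<in> ideal_prod I J"
  unfolding ideal_prod_def
  by (rule CollectI, rule exI[of _ 1], rule exI[of _ "\<lambda>_. a"], rule exI[of _ "\<lambda>_. b"])
    (use assms in simp)

lemma add_in_ideal_prod:
  assumes "x \<in> ideal_prod I J" "y \<in> ideal_prod I J"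
  shows "x + y \<in> ideal_prod I J"
proof -
  obtain n a b where x: "x = (\<Sum>i<n. a i * b i)" and ab: "\<forall>i<(n::nat). a i \<in> I \<and> b i \<in> J"
    using assms(1) unfolding ideal_prod_def by blast
  obtain m c d where y: "y = (\<Sum>i<m. c i * d i)" and cd: "\<forall>i<(m::nat). c i \<in> I \<and> d i \<in> J"
    using assms(2) unfolding ideal_prod_def by blast
  \<comment> \<open>The two families of summands are concatenated, the second one shifted by
    \<open>n\<close>.\<close>
  define p where "p = (\<lambda>i. if i < n then a i else c (i - n))"
  define q where "q = (\<lambda>i. if i < n then b i else d (i - n))"
  have "(\<Sum>i<n + m. p i * q i) = x + y"
    unfolding x y by (induction m) (simp_all add: p_def q_def add.assoc)
  moreover have "\<forall>i<n + m. p i \<in> I \<and> q i \<in> J"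
    using ab cd by (auto simp: p_def q_def)
  ultimately show ?thesis
    unfolding ideal_prod_def by (intro CollectI exI[of _ "n + m"] exI[of _ p] exI[of _ q]) simp
qed

text \<open>The product is the smallest additively closed set that contains 0 and all single
  products. Later inclusions out of a product are therefore checked on single products, without
  indexed sums.\<close>

lemma ideal_prod_subsetI:
  assumes "0 \<in> C" and "\<And>x y. x \<in> C \<Longrightarrow> y \<in> C \<Longrightarrow> x + y \<in> C"
    and "\<And>a b. a \<in> I \<Longrightarrow> b \<in> J \<Longrightarrow> a * b \<in> C"
  shows "ideal_prod I J \<subseteq> C"
proof
  fix x assume "x \<in> ideal_prod I J"
  then obtain n a b where "x = (\<Sum>i<n. a i * b i)" and "\<forall>i<(n::nat). a i \<in> I \<and> b i \<in> J"
    unfolding ideal_prod_def by blast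
  moreover have "(\<Sum>i<n. a i * b i) \<in> C" if "\<forall>i<n. a i \<in> I \<and> b i \<in> J" for n :: nat and a b
    using that by (induction n) (simp_all add: assms)
  ultimately show "x \<in> C" by blast
qed

lemma ideal_prod_mono:
  assumes "I \<subseteq> I'" "J \<subseteq> J'"
  shows "ideal_prod I J \<subseteq> ideal_prod I' J'"
  using assms
  by (intro ideal_prod_subsetI) (auto intro: zero_in_ideal_prod add_in_ideal_prod mult_in_ideal_prod)

lemma ideal_prod_commute: "ideal_prod I J = ideal_prod J I"
proof -
  have "ideal_prod I J \<subseteq> ideal_prod J I" for I J :: "'a set"
    by (intro ideal_prod_subsetI zero_in_ideal_prod add_in_ideal_prod)
      (metis mult_in_ideal_prod mult.commute)+
  then show ?thesis by blast
qed

lemma ideal_prod_assoc_subset: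
  "ideal_prod (ideal_prod I J) L \<subseteq> ideal_prod I (ideal_prod J L)"
proof (intro ideal_prod_subsetI zero_in_ideal_prod add_in_ideal_prod)
  fix x c assume "x \<in> ideal_prod I J" and c: "c \<in> L"
  \<comment> \<open>With \<open>c\<close> fixed, the elements that \<open>c\<close> multiplies into
    the right-hand side form an additively closed set, so single products \<open>a * b\<close>
    suffice.\<close>
  moreover have "ideal_prod I J \<subseteq> {x. x * c \<in> ideal_prod I (ideal_prod J L)}"
  proof (rule ideal_prod_subsetI)
    fix a b assume "a \<in> I" "b \<in> J"
    then show "a * b \<in> {x. x * c \<in> ideal_prod I (ideal_prod J L)}"
      using c by (simp add: mult.assoc mult_in_ideal_prod)
  qed (simp_all add: zero_in_ideal_prod add_in_ideal_prod distrib_right)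
  ultimately show "x * c \<in> ideal_prod I (ideal_prod J L)" by blast
qed

interpretation ideal_prod: abel_semigroup ideal_prod
proof
  show "ideal_prod (ideal_prod I J) L = ideal_prod I (ideal_prod J L)" for I J L :: "'a set"
    \<comment> \<open>The reverse inclusion is the same statement with \<open>I\<close> and
      \<open>L\<close> exchanged, rewritten by commutativity.\<close>
    using ideal_prod_assoc_subset[of I J L] ideal_prod_assoc_subset[of L J I]
    by (metis ideal_prod_commute subset_antisym)
qed (rule ideal_prod_commute)

lemmas ideal_prod_ac = ideal_prod.assoc ideal_prod.commute ideal_prod.left_commute

text \<open>Together with an equation \<open>ideal_prod J J' = S\<close>, this is what lets an
  invertible factor be cancelled.\<close>

lemma ideal_prod_unit:
  assumes "is_submodule S I" "1 \<in> S"
  shows "ideal_prod I S = I"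
proof
  show "ideal_prod I S \<subseteq> I"
  proof (rule ideal_prod_subsetI)
    show "a * s \<in> I" if "a \<in> I" "s \<in> S" for a s
      using assms that by (metis is_submodule_def mult.commute)
  qed (use assms in \<open>auto simp: is_submodule_def\<close>)
  show "I \<subseteq> ideal_prod I S"
    using mult_in_ideal_prod[of _ I 1 S] assms(2) by auto
qed

text \<open>Scalars pass through products. This yields closure of products under scalars,
  compatibility with colons, and later the absorption of the unit of an isomorphism into one
  factor.\<close>

lemma ideal_prod_image_left: "ideal_prod ((*) a ` I) J = (*) a ` ideal_prod I J"
proof
  show "ideal_prod ((*) a ` I) J \<subseteq> (*) a ` ideal_prod I J"
  proof (rule ideal_prod_subsetI)
    show "0 \<in> (*) a ` ideal_prod I J"
      using zero_in_ideal_prod[of I J] by force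
    show "x + y \<in> (*) a ` ideal_prod I J"
      if "x \<in> (*) a ` ideal_prod I J" "y \<in> (*) a ` ideal_prod I J" for x y
      using that add_in_ideal_prod[of _ I J] by (auto simp flip: distrib_left)
    show "x * b \<in> (*) a ` ideal_prod I J" if "x \<in> (*) a ` I" "b \<in> J" for x b
      using that mult_in_ideal_prod[of _ I _ J] by (auto simp: mult.assoc)
  qed
  have "ideal_prod I J \<subseteq> {x. a * x \<in> ideal_prod ((*) a ` I) J}"
  proof (rule ideal_prod_subsetI)
    show "x * y \<in> {x. a * x \<in> ideal_prod ((*) a ` I) J}" if "x \<in> I" "y \<in> J" for x y
      using that mult_in_ideal_prod[of "a * x" "(*) a ` I" y J] by (simp add: mult.assoc)
  qed (auto simp: zero_in_ideal_prod add_in_ideal_prod distrib_left)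
  then show "(*) a ` ideal_prod I J \<subseteq> ideal_prod ((*) a ` I) J" by blast
qed

text \<open>Rescaling an invertible ideal by a unit keeps it invertible: its inverse is rescaled by
  the inverse unit.\<close>

lemma ideal_prod_image_inverse:
  fixes a b :: "'k::comm_ring_1"
  assumes "a * b = 1"
  shows "ideal_prod ((*) a ` I) ((*) b ` J) = ideal_prod I J"
proof -
  have "ideal_prod ((*) a ` I) ((*) b ` J) = (*) a ` (*) b ` ideal_prod J I"
    by (simp add: ideal_prod_image_left ideal_prod.commute[of I])
  also have "\<dots> = ideal_prod J I"
    by (simp add: image_image assms flip: mult.assoc)
  finally show ?thesis by (simp add: ideal_prod.commute)
qed

lemma ideal_prod_submodule:
  assumes "is_submodule S I"
  shows "is_submodule S (ideal_prod I J)"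
  unfolding is_submodule_def
proof (intro conjI ballI)
  fix r x assume r: "r \<in> S" and x: "x \<in> ideal_prod I J"
  have "ideal_prod ((*) r ` I) J \<subseteq> ideal_prod I J"
    using assms r by (intro ideal_prod_mono) (auto simp: is_submodule_def)
  then show "r * x \<in> ideal_prod I J"
    using x by (auto simp: ideal_prod_image_left)
qed (auto intro: zero_in_ideal_prod add_in_ideal_prod)

lemma image_mult_submodule:
  assumes "is_submodule S J"
  shows "is_submodule S ((*) a ` J)"
  unfolding is_submodule_def
proof (intro conjI ballI)
  show "0 \<in> (*) a ` J" using assms by (intro image_eqI[of _ _ 0]) (simp_all add: is_submodule_def)
  fix x assume "x \<in> (*) a ` J"
  then obtain u where u: "x = a * u" "u \<in> J" by blast
  show "x + y \<in> (*) a ` J" if "y \<in> (*) a ` J" for y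
  proof -
    obtain v where v: "y = a * v" "v \<in> J" using \<open>y \<in> (*) a ` J\<close> by blast
    show ?thesis
      using assms u v
      by (intro image_eqI[of _ _ "u + v"]) (simp_all add: is_submodule_def distrib_left)
  qed
  show "r * x \<in> (*) a ` J" if "r \<in> S" for r
    using assms u that
    by (intro image_eqI[of _ _ "r * u"]) (simp_all add: is_submodule_def mult.left_commute)
qed

section \<open>Colon sets and multiplicator rings\<close>

text \<open>This adjunction turns statements about colons into statements about products, where
  associativity and commutativity can be used.\<close>

lemma subset_colon_iff:
  assumes "is_submodule S I"
  shows "L \<subseteq> colon I J \<longleftrightarrow> ideal_prod L J \<subseteq> I"
proof
  assume "L \<subseteq> colon I J"
  then show "ideal_prod L J \<subseteq> I"
    using assms by (intro ideal_prod_subsetI) (auto simp: is_submodule_def colon_def)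
next
  assume "ideal_prod L J \<subseteq> I"
  then show "L \<subseteq> colon I J"
    using mult_in_ideal_prod[of _ L _ J] by (auto simp: colon_def)
qed

text \<open>If \<open>x\<close> maps \<open>J\<close> into \<open>I\<close>, multiplying both sides
  by \<open>L\<close> preserves the inclusion.\<close>

lemma colon_subset_colon_ideal_prod: "colon I J \<subseteq> colon (ideal_prod I L) (ideal_prod J L)"
proof
  fix x assume "x \<in> colon I J"
  then have "(*) x ` J \<subseteq> I" by (auto simp: colon_def)
  then have "ideal_prod ((*) x ` J) L \<subseteq> ideal_prod I L" by (intro ideal_prod_mono) auto
  then show "x \<in> colon (ideal_prod I L) (ideal_prod J L)"
    by (auto simp: ideal_prod_image_left colon_def)
qed

text \<open>With \<open>I = J\<close> this makes the multiplicator ring invariant under unit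
  multiples, hence under isomorphism, which separates the entries coming from different
  over-orders.\<close>

lemma colon_image_unit:
  fixes a :: "'k::comm_ring_1"
  assumes "a dvd 1"
  shows "colon ((*) a ` I) ((*) a ` J) = colon I J"
proof -
  obtain b where b: "b * a = 1" using assms by (metis dvdE mult.commute)
  have "x * (a * y) \<in> (*) a ` I \<longleftrightarrow> x * y \<in> I" for x y
  proof
    assume "x * (a * y) \<in> (*) a ` I"
    then obtain z where "z \<in> I" "x * (a * y) = a * z" by blast
    moreover from this have "b * a * (x * y) = b * a * z"
      by (metis mult.assoc mult.left_commute)
    ultimately show "x * y \<in> I" by (simp add: b)
  qed (auto simp: mult.left_commute)
  then show ?thesis by (auto simp: colon_def)
qed

lemma one_in_colon: "1 \<in> colon I I"
  by (simp add: colon_def)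

lemma colon_self_subring:
  assumes "int_module.subspace I"
  shows "is_subring (colon I I)"
  using int_module.subspace_diff[OF assms]
  by (auto simp: is_subring_def colon_def left_diff_distrib mult.assoc)

lemma colon_self_submodule: "int_module.subspace I \<Longrightarrow> is_submodule (colon I I) I"
  by (auto simp: is_submodule_def colon_def int_module.subspace_0 int_module.subspace_add)

lemma colon_submodule:
  "is_submodule S I \<Longrightarrow> is_submodule S (colon I J)"
  by (auto simp: is_submodule_def colon_def distrib_right mult.assoc)

section \<open>Lattices\<close>

lemma of_int_in_subring:
  assumes "is_subring S"
  shows "of_int n \<in> S"
proof -
  have diff: "x - y \<in> S" if "x \<in> S" "y \<in> S" for x y
    using assms that by (auto simp: is_subring_def)
  have 1: "1 \<in> S" using assms by (simp add: is_subring_def)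
  have 0: "0 \<in> S" using diff[OF 1 1] by simp
  show ?thesis
  proof (induction n rule: int_induct[where k = 0])
    case (step1 i)
    \<comment> \<open>The successor is written as a difference because \<open>is_subring\<close>
      grants closure under subtraction only.\<close>
    have "of_int i - (0 - 1) \<in> S" using step1 0 1 by (intro diff)
    then show ?case by simp
  next
    case (step2 i)
    then show ?case using diff[of "of_int i" 1] 1 by simp
  qed (simp add: 0)
qed

lemma submodule_subspace:
  assumes "is_subring S" "is_submodule S I"
  shows "int_module.subspace I"
  using assms of_int_in_subring[OF assms(1)]
  by (auto simp: int_module.subspace_def is_submodule_def)

text \<open>Subgroups of finitely generated abelian groups are finitely generated. The induction
  removes one generator \<open>f\<close> at a time, by Euclidean division of the coefficients of
  \<open>f\<close>. It is needed for colon ideals.\<close>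

lemma subspace_finitely_spanned:
  fixes N :: "'k::comm_ring_1 set"
  assumes "finite F" "int_module.subspace N" "N \<subseteq> int_module.span F"
  shows "\<exists>G. finite G \<and> int_module.span G = N"
  using assms
proof (induction F arbitrary: N rule: finite_induct)
  case empty
  then have "N = {0}"
    using int_module.subspace_0 by (auto simp: int_module.span_empty)
  then show ?case by (intro exI[of _ "{}"]) simp
next
  case (insert f F)
  note N = insert.prems(1)
  \<comment> \<open>\<open>k\<close> is a possible coefficient of \<open>f\<close> in
    \<open>x\<close>; it need not be unique, since the generators may be dependent.\<close>
  define coef where "coef k x \<longleftrightarrow> x \<in> N \<and> x - of_int k * f \<in> int_module.span F" for k x
  have coef_ex: "\<exists>k. coef k x" if "x \<in> N" for x
    using that insert.prems(2) by (auto simp: int_module.span_insert coef_def)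
  obtain G where G: "finite G" "int_module.span G = N \<inter> int_module.span F"
    using insert.IH[of "N \<inter> int_module.span F"] N
    by (auto intro: int_module.subspace_inter)
  show ?case
  proof (cases "\<exists>k x. k > 0 \<and> coef k x")
    case False
    \<comment> \<open>Negating an element negates its coefficient, so without positive coefficients
      there are no negative ones either.\<close>
    have "N \<subseteq> int_module.span F"
    proof
      fix x assume "x \<in> N"
      then obtain k where k: "coef k x" using coef_ex by blast
      then have "coef (- k) (- x)"
        using int_module.subspace_neg[OF N] int_module.span_neg[of "x - of_int k * f" F]
        by (auto simp: coef_def)
      with k False have "k = 0" by (metis neg_0_less_iff_less linorder_neqE)
      then show "x \<in> int_module.span F" using k by (simp add: coef_def)
    qed
    then show ?thesis using insert.IH N by blast
  next
    case True
    \<comment> \<open>The least positive coefficient \<open>d\<close> is chosen among the naturals.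
      An element \<open>x\<^sub>0\<close> attaining it generates \<open>N\<close> together with the
      generators \<open>G\<close> of the part of \<open>N\<close> inside the span of
      \<open>F\<close>.\<close>
    define P where "P n \<longleftrightarrow> 0 < n \<and> (\<exists>x. coef (int n) x)" for n
    have "\<exists>n. P n"
      using True unfolding P_def by (metis zero_less_imp_eq_int of_nat_0_less_iff)
    then have least: "P (LEAST n. P n)" and min: "\<And>n. P n \<Longrightarrow> (LEAST n. P n) \<le> n"
      by (auto intro: LeastI_ex Least_le)
    define d where "d = int (LEAST n. P n)"
    have d: "d > 0" using least by (simp add: d_def P_def)
    obtain x\<^sub>0 where x0: "coef d x\<^sub>0" using least by (auto simp: d_def P_def)
    have "int_module.span (insert x\<^sub>0 G) = N"
    proof
      have "G \<subseteq> N" using G(2) int_module.span_superset[of G] by blast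
      then show "int_module.span (insert x\<^sub>0 G) \<subseteq> N"
        using x0 N by (intro int_module.span_minimal) (auto simp: coef_def)
      show "N \<subseteq> int_module.span (insert x\<^sub>0 G)"
      proof
        fix x assume "x \<in> N"
        then obtain k where k: "coef k x" using coef_ex by blast
        define y where "y = x - of_int (k div d) * x\<^sub>0"
        have "y - of_int (k mod d) * f
            = (x - of_int k * f) - of_int (k div d) * (x\<^sub>0 - of_int d * f)"
          unfolding y_def minus_div_mult_eq_mod[symmetric] by (simp add: algebra_simps)
        then have "y - of_int (k mod d) * f \<in> int_module.span F"
          using k x0 by (simp add: coef_def int_module.span_diff int_module.span_scale)
        moreover have "y \<in> N"
          using k x0 N unfolding y_def coef_def
          by (intro int_module.subspace_diff int_module.subspace_scale) auto
        ultimately have y: "coef (k mod d) y" by (simp add: coef_def)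
        \<comment> \<open>The remainder is again a coefficient, that of \<open>y\<close>, and lies
          below \<open>d\<close>; minimality forces it to vanish.\<close>
        have "k mod d = 0"
        proof (rule ccontr)
          assume "k mod d \<noteq> 0"
          then have pos: "k mod d > 0" using d by (simp add: order_less_le)
          then have "P (nat (k mod d))" using y by (auto simp: P_def)
          then have "d \<le> k mod d" using min pos by (fastforce simp: d_def)
          then show False using pos_mod_bound[OF d, of k] by linarith
        qed
        then have "y \<in> int_module.span G" using y by (simp add: G(2) coef_def)
        then show "x \<in> int_module.span (insert x\<^sub>0 G)"
          by (auto simp: int_module.span_insert y_def)
      qed
    qed
    then show ?thesis using G(1) by blast
  qed
qed

section \<open>Full lattices and their stability under products and colons\<close>

text \<open>These are the finiteness and rank conditions of a fractional ideal with the ring of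
  scalars removed, so that one predicate serves \<open>R\<close> and all its over-orders.\<close>

definition full_lattice :: "'k::comm_ring_1 set \<Rightarrow> bool" where
  "full_lattice I \<longleftrightarrow>
     (\<exists>F. finite F \<and> int_module.span F = I) \<and> (\<forall>x. \<exists>n::int. n \<noteq> 0 \<and> of_int n * x \<in> I)"

lemma full_lattice_subspace: "full_lattice I \<Longrightarrow> int_module.subspace I"
  by (auto simp: full_lattice_def)

text \<open>By bilinearity the products of generators generate the product, so finite generation
  over the integers passes to products. One factor is expanded at a time.\<close>

lemma ideal_prod_span:
  fixes F G :: "'k::comm_ring_1 set"
  shows "ideal_prod (int_module.span F) (int_module.span G)
    = int_module.span {f * g | f g. f \<in> F \<and> g \<in> G}" (is "_ = int_module.span ?P")
proof
  have *: "f * y \<in> int_module.span ?P" if "f \<in> F" "y \<in> int_module.span G" for f y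
    using that(2)
  proof (induction rule: int_module.span_induct_alt)
    case (step n g y)
    have "f * g \<in> int_module.span ?P" using that step by (intro int_module.span_base) auto
    then have "of_int n * (f * g) + f * y \<in> int_module.span ?P"
      using step by (intro int_module.span_add int_module.span_scale)
    then show ?case by (simp add: algebra_simps)
  qed (simp add: int_module.span_zero)
  have **: "x * y \<in> int_module.span ?P"
    if "x \<in> int_module.span F" "y \<in> int_module.span G" for x y
    using that(1)
  proof (induction rule: int_module.span_induct_alt)
    case (step n f x)
    then have "of_int n * (f * y) + x * y \<in> int_module.span ?P"
      using * that by (intro int_module.span_add int_module.span_scale)
    then show ?case by (simp add: algebra_simps)
  qed (simp add: int_module.span_zero)
  show "ideal_prod (int_module.span F) (int_module.span G) \<subseteq> int_module.span ?P"
    by (intro ideal_prod_subsetI int_module.span_zero int_module.span_add **)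
  have "of_int n * x \<in> ideal_prod (int_module.span F) (int_module.span G)"
    if "x \<in> ideal_prod (int_module.span F) (int_module.span G)" for n x
  proof -
    have "(*) (of_int n) ` int_module.span F \<subseteq> int_module.span F"
      by (auto intro: int_module.span_scale)
    from ideal_prod_mono[OF this order_refl] that show ?thesis
      by (auto simp: ideal_prod_image_left)
  qed
  then have "int_module.subspace (ideal_prod (int_module.span F) (int_module.span G))"
    by (simp add: int_module.subspace_def zero_in_ideal_prod add_in_ideal_prod)
  then show "int_module.span ?P \<subseteq> ideal_prod (int_module.span F) (int_module.span G)"
    by (intro int_module.span_minimal) (auto intro!: mult_in_ideal_prod int_module.span_base)
qed

lemma full_lattice_ideal_prod:
  assumes "full_lattice I" "full_lattice J"
  shows "full_lattice (ideal_prod I J)"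
  unfolding full_lattice_def
proof (intro conjI allI)
  obtain F G where F: "finite F" "int_module.span F = I" and G: "finite G" "int_module.span G = J"
    using assms by (auto simp: full_lattice_def)
  have "{f * g | f g. f \<in> F \<and> g \<in> G} = (\<lambda>(f, g). f * g) ` (F \<times> G)" by auto
  then have "finite {f * g | f g. f \<in> F \<and> g \<in> G}" using F G by simp
  then show "\<exists>F. finite F \<and> int_module.span F = ideal_prod I J"
    using ideal_prod_span[of F G] F G by auto
  fix x
  obtain n m :: int where "n \<noteq> 0" "of_int n * x \<in> I" "m \<noteq> 0" "of_int m * 1 \<in> J"
    using assms unfolding full_lattice_def by meson
  then show "\<exists>n::int. n \<noteq> 0 \<and> of_int n * x \<in> ideal_prod I J"
    using mult_in_ideal_prod[of "of_int n * x" I "of_int m" J]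
    by (intro exI[of _ "n * m"]) (simp add: ac_simps)
qed

lemma common_denominator:
  fixes I :: "'k::comm_ring_1 set"
  assumes "int_module.subspace I" "\<And>x. \<exists>n::int. n \<noteq> 0 \<and> of_int n * x \<in> I" "finite G"
  shows "\<exists>n::int. n \<noteq> 0 \<and> (\<forall>g\<in>G. of_int n * g \<in> I)"
  using assms(3)
proof induction
  case (insert g G)
  then obtain n :: int where n: "n \<noteq> 0" "\<forall>g\<in>G. of_int n * g \<in> I" by blast
  obtain m :: int where m: "m \<noteq> 0" "of_int m * g \<in> I" using assms(2) by blast
  have "of_int m * (of_int n * h) \<in> I" "of_int n * (of_int m * g) \<in> I" if "h \<in> G" for h
    using that n m int_module.subspace_scale[OF assms(1)] by blast+
  moreover have "of_int n * (of_int m * g) \<in> I"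
    using m int_module.subspace_scale[OF assms(1)] by blast
  ultimately show ?case
    using n m by (intro exI[of _ "m * n"]) (auto simp: ac_simps)
qed (auto intro: exI[of _ 1])

text \<open>A nonzero integer \<open>n\<close> in \<open>J\<close> confines the colon to
  \<open>I\<close> divided by \<open>n\<close>, a finitely generated group, and subgroups of such
  groups are finitely generated. For the rank condition, a common denominator of the products of
  \<open>x\<close> with generators of \<open>J\<close> multiplies \<open>x\<close> into the
  colon.\<close>

lemma full_lattice_colon:
  fixes I J :: "'k::comm_ring_1 set"
  assumes unit: "\<And>n::int. n \<noteq> 0 \<Longrightarrow> (of_int n :: 'k) dvd 1"
    and I: "full_lattice I" and J: "full_lattice J"
  shows "full_lattice (colon I J)"
  unfolding full_lattice_def
proof (intro conjI allI)
  have sub: "int_module.subspace I" using I by (rule full_lattice_subspace)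
  have subcolon: "int_module.subspace (colon I J)"
    using sub by (auto simp: int_module.subspace_def colon_def distrib_right mult.assoc)
  obtain F where F: "finite F" "int_module.span F = I" using I by (auto simp: full_lattice_def)
  obtain G where G: "finite G" "int_module.span G = J" using J by (auto simp: full_lattice_def)
  obtain n :: int where n: "n \<noteq> 0" "of_int n * 1 \<in> J"
    using J unfolding full_lattice_def by meson
  obtain b :: 'k where b: "of_int n * b = 1" using unit[OF n(1)] by (metis dvdE)
  have bI: "b * y \<in> int_module.span ((*) b ` F)" if "y \<in> int_module.span F" for y
    using that
  proof (induction rule: int_module.span_induct_alt)
    case (step k f y)
    have "b * f \<in> int_module.span ((*) b ` F)"
      using step by (intro int_module.span_base) auto
    then have "of_int k * (b * f) + b * y \<in> int_module.span ((*) b ` F)"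
      using step by (intro int_module.span_add int_module.span_scale)
    then show ?case by (simp add: algebra_simps)
  qed (simp add: int_module.span_zero)
  have "colon I J \<subseteq> int_module.span ((*) b ` F)"
  proof
    fix x assume "x \<in> colon I J"
    then have "x * of_int n \<in> I" using n by (auto simp: colon_def)
    then have "b * (x * of_int n) \<in> int_module.span ((*) b ` F)" using bI F by blast
    moreover have "b * (x * of_int n) = x" using b by (metis mult.assoc mult.commute mult_1_right)
    ultimately show "x \<in> int_module.span ((*) b ` F)" by simp
  qed
  then show "\<exists>F. finite F \<and> int_module.span F = colon I J"
    using F(1) subcolon by (intro subspace_finitely_spanned) auto
  fix x
  obtain m :: int where m: "m \<noteq> 0" "\<forall>g\<in>G. of_int m * (x * g) \<in> I"
    using common_denominator[OF sub _ finite_imageI[OF G(1), of "(*) x"]] I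
    by (auto simp: full_lattice_def)
  have "of_int m * x * y \<in> I" if "y \<in> int_module.span G" for y
    using that
  proof (induction rule: int_module.span_induct_alt)
    case (step k g y)
    have "of_int k * (of_int m * (x * g)) \<in> I"
      using m step by (intro int_module.subspace_scale[OF sub, where c = k]) blast
    then have "of_int k * (of_int m * (x * g)) + of_int m * x * y \<in> I"
      using step by (intro int_module.subspace_add[OF sub])
    then show ?case by (simp add: algebra_simps)
  qed (simp add: int_module.subspace_0[OF sub])
  then show "\<exists>n::int. n \<noteq> 0 \<and> of_int n * x \<in> colon I J"
    using m(1) G(2) by (auto simp: colon_def)
qed

section \<open>Fractional ideals\<close>

text \<open>Generators over the integers also generate over \<open>S\<close>, since the integers lie
  in \<open>S\<close>.\<close>

lemma finitely_generatedI_span: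
  assumes "is_subring S" "is_submodule S I" "finite F" "int_module.span F = I"
  shows "finitely_generated S I"
  unfolding finitely_generated_def
proof (intro exI[of _ F] conjI equalityI subsetI)
  fix x assume "x \<in> I"
  then obtain u where "x = (\<Sum>g\<in>F. of_int (u g) * g)"
    using assms(3,4) int_module.span_finite[of F] by auto
  then show "x \<in> {\<Sum>g\<in>F. c g * g | c. \<forall>g\<in>F. c g \<in> S}"
    using of_int_in_subring[OF assms(1)]
    by (intro CollectI exI[of _ "\<lambda>g. of_int (u g)"]) auto
next
  fix x assume "x \<in> {\<Sum>g\<in>F. c g * g | c. \<forall>g\<in>F. c g \<in> S}"
  then obtain c where x: "x = (\<Sum>g\<in>F. c g * g)" and c: "\<forall>g\<in>F. c g \<in> S" by blast
  have "F \<subseteq> I" using assms(4) int_module.span_superset by blast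
  then show "x \<in> I"
    unfolding x using c assms(2)
    by (intro int_module.subspace_sum submodule_subspace[OF assms(1,2)]) (auto simp: is_submodule_def)
qed (rule assms(3))

text \<open>Conversely, products of integral generators of \<open>S\<close> with
  \<open>S\<close>-generators of \<open>I\<close> generate \<open>I\<close> over the
  integers.\<close>

lemma finitely_generatedD_span:
  fixes S I :: "'k::comm_ring_1 set"
  assumes "is_subring S" "finite B" "int_module.span B = S" "is_submodule S I"
    and "finitely_generated S I"
  shows "\<exists>F. finite F \<and> int_module.span F = I"
proof -
  obtain G where G: "finite G" and I: "I = {\<Sum>g\<in>G. c g * g | c. \<forall>g\<in>G. c g \<in> S}"
    using assms(5) by (auto simp: finitely_generated_def)
  have 01: "1 \<in> S" "0 \<in> S" using of_int_in_subring[OF assms(1), of 1]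
      of_int_in_subring[OF assms(1), of 0] by auto
  have "G \<subseteq> I"
  proof
    fix g assume g: "g \<in> G"
    \<comment> \<open>Kronecker delta coefficients exhibit \<open>g\<close> as a combination of
      \<open>G\<close>.\<close>
    have "(\<Sum>h\<in>G. (if h = g then 1 else 0) * h) = (\<Sum>h\<in>G. if h = g then h else 0)"
      by (intro sum.cong) auto
    also have "\<dots> = g" using g G by simp
    finally show "g \<in> I"
      unfolding I using 01 by (intro CollectI exI[of _ "\<lambda>h. if h = g then 1 else 0"]) auto
  qed
  have "I = ideal_prod S (int_module.span G)"
  proof
    show "I \<subseteq> ideal_prod S (int_module.span G)"
    proof
      fix x assume "x \<in> I"
      then obtain c where x: "x = (\<Sum>g\<in>G. c g * g)" and c: "\<forall>g\<in>G. c g \<in> S"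
        using I by blast
      have "(\<Sum>g\<in>H. c g * g) \<in> ideal_prod S (int_module.span G)" if "H \<subseteq> G" for H
        using finite_subset[OF that G] that
        by (induction H rule: finite_induct)
          (use c in \<open>auto intro!: zero_in_ideal_prod add_in_ideal_prod mult_in_ideal_prod
             int_module.span_base\<close>)
      then show "x \<in> ideal_prod S (int_module.span G)" using x by blast
    qed
    have "int_module.span G \<subseteq> I"
      using \<open>G \<subseteq> I\<close> submodule_subspace[OF assms(1,4)] by (rule int_module.span_minimal)
    then show "ideal_prod S (int_module.span G) \<subseteq> I"
      using assms(4) by (intro ideal_prod_subsetI) (auto simp: is_submodule_def)
  qed
  then have "I = int_module.span {b * g | b g. b \<in> B \<and> g \<in> G}"
    using assms(3) ideal_prod_span by blast
  moreover have "{b * g | b g. b \<in> B \<and> g \<in> G} = (\<lambda>(b, g). b * g) ` (B \<times> G)" by auto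
  then have "finite {b * g | b g. b \<in> B \<and> g \<in> G}" using assms(2) G by simp
  ultimately show ?thesis by blast
qed

text \<open>After this translation, a change of the base order affects the submodule condition
  only.\<close>

lemma fractional_ideal_iff:
  assumes "is_subring S" "finite B" "int_module.span B = S"
  shows "fractional_ideal S I \<longleftrightarrow> is_submodule S I \<and> full_lattice I"
  using finitely_generatedI_span[OF assms(1)] finitely_generatedD_span[OF assms]
  unfolding fractional_ideal_def full_lattice_def by blast

lemma order_fractional_ideal_iff:
  assumes "is_order R"
  shows "fractional_ideal R I \<longleftrightarrow> is_submodule R I \<and> full_lattice I"
  using assms fractional_ideal_iff unfolding is_order_def by blast

lemma over_order_fractional_ideal_iff:
  assumes "is_order R" "S \<in> over_orders R"
  shows "fractional_ideal S I \<longleftrightarrow> is_submodule S I \<and> full_lattice I"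
  using assms fractional_ideal_iff[of S]
  by (auto simp: over_orders_def order_fractional_ideal_iff full_lattice_def)

lemma over_order_superset:
  assumes "S \<in> over_orders R"
  shows "R \<subseteq> S"
proof
  fix r assume "r \<in> R"
  then have "r * 1 \<in> S"
    using assms unfolding over_orders_def fractional_ideal_def is_submodule_def is_subring_def
    by blast
  then show "r \<in> S" by simp
qed

lemma over_order_ideal_imp_ideal:
  assumes "is_order R" "S \<in> over_orders R" "fractional_ideal S I"
  shows "fractional_ideal R I"
  using assms over_order_superset[OF assms(2)]
  by (auto simp: order_fractional_ideal_iff over_order_fractional_ideal_iff is_submodule_def)

text \<open>Freeness over the integers makes \<open>n\<close> a non-zero-divisor of
  \<open>R\<close>, and those are units in the total quotient ring.\<close>

lemma order_int_unit:
  fixes R :: "'k::comm_ring_1 set" and n :: int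
  assumes R: "is_order R" and n: "n \<noteq> 0"
  shows "(of_int n :: 'k) dvd 1"
proof -
  obtain B where B: "finite B" "int_module.independent B" "int_module.span B = R"
    using R unfolding is_order_def by blast
  have "x = 0" if "x \<in> R" "of_int n * x = 0" for x
  proof -
    obtain u where u: "x = (\<Sum>b\<in>B. of_int (u b) * b)"
      using \<open>x \<in> R\<close> int_module.span_finite[OF B(1)] unfolding B(3) by blast
    have "(\<Sum>b\<in>B. of_int (n * u b) * b) = 0"
      using that(2) unfolding u sum_distrib_left of_int_mult mult.assoc .
    then have "n * u b = 0" if "b \<in> B" for b
      using int_module.independentD[OF B(2,1) order_refl, of "\<lambda>b. n * u b"] that by blast
    then have "u b = 0" if "b \<in> B" for b using n that by simp
    then show "x = 0" unfolding u by (intro sum.neutral) simp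
  qed
  moreover have "of_int n \<in> R"
    using R by (intro of_int_in_subring) (simp add: is_order_def)
  ultimately have "nonzerodivisor_in R (of_int n)"
    unfolding nonzerodivisor_in_def by blast
  then show ?thesis
    using R unfolding is_order_def UNIV_is_total_quotient_ring_def by blast
qed

text \<open>This ensures that the over-order attached to a given ideal occurs in the list the
  algorithm runs through.\<close>

lemma multiplicator_ring_over_order:
  assumes "is_order R" "fractional_ideal R I"
  shows "colon I I \<in> over_orders R"
proof -
  have I: "is_submodule R I" "full_lattice I"
    using assms by (simp_all add: order_fractional_ideal_iff)
  have "full_lattice (colon I I)"
    using order_int_unit[OF assms(1)] I by (intro full_lattice_colon)
  then show ?thesis
    using assms(1) colon_submodule[OF I(1)] colon_self_subring[OF full_lattice_subspace[OF I(2)]]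
    by (simp add: over_orders_def order_fractional_ideal_iff)
qed

section \<open>Module isomorphisms as multiplication by units\<close>

text \<open>Clearing the denominators of \<open>x\<close> and \<open>y\<close> gives \<open>x f(y) = y f(x)\<close>; take for \<open>y\<close> an integer in \<open>I\<close>.\<close>
lemma linear_map_is_multiplication:
  fixes R I :: "'k::comm_ring_1 set" and f :: "'k \<Rightarrow> 'k"
  assumes R: "is_order R" and I: "full_lattice I"
    and f: "\<And>r x. r \<in> R \<Longrightarrow> x \<in> I \<Longrightarrow> f (r * x) = r * f x"
  shows "\<exists>a. \<forall>x\<in>I. f x = a * x"
proof -
  have denom: "\<exists>s\<in>R. s dvd 1 \<and> s * x \<in> R" for x
    using R unfolding is_order_def UNIV_is_total_quotient_ring_def nonzerodivisor_in_def by metis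
  have mult: "r * s \<in> R" if "r \<in> R" "s \<in> R" for r s
    using R that by (auto simp: is_order_def is_subring_def)
  have comm: "x * f y = y * f x" if "x \<in> I" "y \<in> I" for x y
  proof -
    obtain s where s: "s \<in> R" "s dvd 1" "s * x \<in> R" using denom by blast
    obtain t where t: "t \<in> R" "t dvd 1" "t * y \<in> R" using denom by blast
    have "f (t * (s * x) * y) = f (s * (t * y) * x)" by (simp add: ac_simps)
    moreover have "f (t * (s * x) * y) = t * (s * x) * f y"
      using f mult s t that by blast
    moreover have "f (s * (t * y) * x) = s * (t * y) * f x"
      using f mult s t that by blast
    ultimately have "t * (s * x) * f y = s * (t * y) * f x" by argo
    then have eq: "(s * t) * (x * f y) = (s * t) * (y * f x)" by (simp add: ac_simps)
    obtain u where "1 = s * t * u" using mult_dvd_mono[OF s(2) t(2)] by (metis dvdE mult_1_left)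
    then have "u * (s * t) = 1" by (simp add: mult.commute)
    then show ?thesis using eq by (metis mult.assoc mult_1_left)
  qed
  obtain n :: int where n: "n \<noteq> 0" "of_int n * 1 \<in> I"
    using I unfolding full_lattice_def by meson
  obtain b :: 'k where b: "of_int n * b = 1" using order_int_unit[OF R n(1)] by (metis dvdE)
  have "f x = (b * f (of_int n)) * x" if "x \<in> I" for x
  proof -
    have "b * (x * f (of_int n)) = b * (of_int n * f x)" using comm[OF that] n by simp
    also have "\<dots> = f x" using b by (metis mult.assoc mult.commute mult_1_left)
    finally show ?thesis by (simp add: ac_simps)
  qed
  then show ?thesis by blast
qed

lemma module_isoI_unit:
  fixes a :: "'k::comm_ring_1"
  assumes "a dvd 1"
  shows "module_iso R I ((*) a ` I)"
  unfolding module_iso_def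
proof (intro exI[of _ "(*) a"] conjI ballI)
  obtain b where "b * a = 1" using assms by (metis dvdE mult.commute)
  then have "inj ((*) a)" by (intro inj_on_inverseI[of _ "(*) b"]) (simp flip: mult.assoc)
  then show "bij_betw ((*) a) I ((*) a ` I)"
    using inj_on_subset[OF _ subset_UNIV] unfolding bij_betw_def by blast
qed (simp_all add: algebra_simps)

text \<open>The map and its inverse are multiplications by some \<open>a\<close> and
  \<open>b\<close>. Evaluating their composite at a nonzero integer in \<open>I\<close>, which is a
  unit, gives \<open>a * b = 1\<close>.\<close>

lemma module_isoD_unit:
  fixes I J :: "'k::comm_ring_1 set"
  assumes R: "is_order R" and I: "fractional_ideal R I" and J: "fractional_ideal R J"
    and "module_iso R I J"
  shows "\<exists>a. a dvd 1 \<and> J = (*) a ` I"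
proof -
  obtain f where f: "bij_betw f I J" "\<And>r x. r \<in> R \<Longrightarrow> x \<in> I \<Longrightarrow> f (r * x) = r * f x"
    using assms(4) unfolding module_iso_def by blast
  have IJ: "is_submodule R I" "full_lattice I" "full_lattice J"
    using R I J by (simp_all add: order_fractional_ideal_iff)
  define g where "g = inv_into I f"
  have gI: "g y \<in> I" and fg: "f (g y) = y" if "y \<in> J" for y
    using f(1) that unfolding g_def
    by (auto intro: inv_into_into f_inv_into_f simp: bij_betw_def)
  have gf: "g (f x) = x" if "x \<in> I" for x
    using f(1) that unfolding g_def by (simp add: bij_betw_def)
  have g: "g (r * y) = r * g y" if "r \<in> R" "y \<in> J" for r y
  proof -
    have "r * g y \<in> I" using IJ(1) that gI by (auto simp: is_submodule_def)
    then have "g (f (r * g y)) = r * g y" by (rule gf)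
    then show ?thesis using that f(2) gI fg by simp
  qed
  obtain a where a: "\<And>x. x \<in> I \<Longrightarrow> f x = a * x"
    using linear_map_is_multiplication[OF R IJ(2) f(2)] by blast
  obtain b where b: "\<And>y. y \<in> J \<Longrightarrow> g y = b * y"
    using linear_map_is_multiplication[OF R IJ(3) g] by blast
  obtain n :: int where n: "n \<noteq> 0" "of_int n * 1 \<in> I"
    using IJ(2) unfolding full_lattice_def by meson
  have "f (of_int n) \<in> J" using f(1) n by (auto simp: bij_betw_def)
  then have ban: "b * (a * of_int n) = of_int n"
    using a[of "of_int n"] b[of "f (of_int n)"] gf[of "of_int n"] n
    by simp
  obtain c :: 'k where c: "of_int n * c = 1" using order_int_unit[OF R n(1)] by (metis dvdE)
  have "a * b = b * a * (of_int n * c)" using c by (simp add: mult.commute)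
  also have "\<dots> = b * (a * of_int n) * c" by (simp only: mult.assoc)
  also have "\<dots> = 1" using ban c by simp
  finally have "a * b = 1" .
  moreover have "J = (*) a ` I" using f(1) a by (auto simp: bij_betw_def)
  ultimately show ?thesis by (metis dvdI)
qed

lemma unit_multiple_sym:
  fixes a :: "'k::comm_ring_1"
  assumes "a dvd 1"
  shows "\<exists>b. b dvd 1 \<and> I = (*) b ` (*) a ` I"
proof -
  obtain b where "b * a = 1" using assms by (metis dvdE mult.commute)
  then have "b dvd 1" using dvd_triv_left[of b a] by simp
  moreover have "I = (*) b ` (*) a ` I"
    using \<open>b * a = 1\<close> by (simp add: image_image flip: mult.assoc)
  ultimately show ?thesis by blast
qed

lemma module_iso_refl: "module_iso R I I"
  using module_isoI_unit[of 1 R I] by simp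

text \<open>\<open>Pic S\<close> uses \<open>S\<close>-linear isomorphisms and \<open>ICM R\<close>
  uses \<open>R\<close>-linear ones; restriction of scalars connects them.\<close>

lemma module_iso_subring:
  assumes "R \<subseteq> S" "module_iso S I J"
  shows "module_iso R I J"
proof -
  obtain f where "bij_betw f I J" "\<forall>x\<in>I. \<forall>y\<in>I. f (x + y) = f x + f y"
    and f: "\<forall>r\<in>S. \<forall>x\<in>I. f (r * x) = r * f x"
    using assms(2) unfolding module_iso_def by blast
  moreover have "\<forall>r\<in>R. \<forall>x\<in>I. f (r * x) = r * f x"
    using f assms(1) by (meson subsetD)
  ultimately show ?thesis unfolding module_iso_def by blast
qed

lemma module_iso_sym:
  assumes "is_order R" "fractional_ideal R I" "fractional_ideal R J" "module_iso R I J"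
  shows "module_iso R J I"
  using module_isoD_unit[OF assms] unit_multiple_sym module_isoI_unit by metis

lemma module_iso_trans:
  assumes "is_order R" "fractional_ideal R I" "fractional_ideal R J" "fractional_ideal R L"
    and "module_iso R I J" "module_iso R J L"
  shows "module_iso R I L"
proof -
  obtain a b where "a dvd 1" "J = (*) a ` I" "b dvd 1" "L = (*) b ` J"
    using module_isoD_unit assms by meson
  then have "b * a dvd 1" "L = (*) (b * a) ` I"
    using mult_dvd_mono[of b 1 a 1] by (auto simp: image_image mult.assoc)
  then show ?thesis using module_isoI_unit by metis
qed

section \<open>Lists of representatives\<close>

lemma classes_memberD:
  assumes "x \<in> \<Union>(classes r A)"
  shows "x \<in> A"
  using assms by (auto simp: classes_def quotient_def)

lemma lists_representatives_subset:
  assumes "lists_representatives xs (classes r A)"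
  shows "set xs \<subseteq> A"
proof
  fix x assume "x \<in> set xs"
  then have "x \<in> \<Union>(classes r A)"
    using assms unfolding lists_representatives_def by (elim conjE subsetD)
  then show "x \<in> A" by (rule classes_memberD)
qed

lemma lists_representatives_ex:
  assumes "lists_representatives xs (classes r A)" "a \<in> A"
  shows "\<exists>x\<in>set xs. r a x"
proof -
  have "{x \<in> A. r a x} \<in> classes r A"
    using assms(2) by (auto simp: classes_def quotient_def)
  then obtain i where "i < length xs" "xs ! i \<in> {x \<in> A. r a x}"
    using assms(1) unfolding lists_representatives_def by metis
  then show ?thesis by auto
qed

text \<open>Uniqueness of positions becomes a condition on pairs of entries in list order, a form
  that can be assembled over concatenated lists. Reflexivity puts position \<open>i\<close> itself
  into the class of its entry.\<close>

lemma lists_representatives_unrelated: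
  assumes "lists_representatives xs (classes r A)" and "\<And>a. a \<in> A \<Longrightarrow> r a a"
  shows "sorted_wrt (\<lambda>x y. \<not> r x y) xs"
  unfolding sorted_wrt_iff_nth_less
proof (intro allI impI notI)
  fix i j assume ij: "i < j" "j < length xs" and r: "r (xs ! i) (xs ! j)"
  have mem: "xs ! k \<in> A" if "k < length xs" for k
    using nth_mem[OF that] by (rule subsetD[OF lists_representatives_subset[OF assms(1)]])
  have i: "i < length xs" using ij by simp
  have "{x \<in> A. r (xs ! i) x} \<in> classes r A"
    using mem[OF i] by (auto simp: classes_def quotient_def)
  then have "\<exists>!k. k < length xs \<and> xs ! k \<in> {x \<in> A. r (xs ! i) x}"
    using assms(1) unfolding lists_representatives_def by (elim conjE bspec)
  then obtain k where k: "\<And>l. l < length xs \<Longrightarrow> xs ! l \<in> {x \<in> A. r (xs ! i) x} \<Longrightarrow> l = k"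
    by (elim ex1E) blast
  have "i = k" using k[OF i] mem[OF i] assms(2)[OF mem[OF i]] by simp
  moreover have "j = k" using k[OF ij(2)] mem[OF ij(2)] r by simp
  ultimately show False using ij(1) by simp
qed

lemma lists_representativesI:
  assumes "set xs \<subseteq> A" and "\<And>a. a \<in> A \<Longrightarrow> \<exists>x\<in>set xs. r a x"
    and "sorted_wrt (\<lambda>x y. \<not> r x y) xs"
    and refl: "\<And>a. a \<in> A \<Longrightarrow> r a a"
    and sym: "\<And>a b. a \<in> A \<Longrightarrow> b \<in> A \<Longrightarrow> r a b \<Longrightarrow> r b a"
    and trans: "\<And>a b c. a \<in> A \<Longrightarrow> b \<in> A \<Longrightarrow> c \<in> A \<Longrightarrow> r a b \<Longrightarrow> r b c \<Longrightarrow> r a c"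
  shows "lists_representatives xs (classes r A)"
  unfolding lists_representatives_def
proof (intro conjI ballI)
  show "set xs \<subseteq> \<Union>(classes r A)"
  proof
    fix x assume "x \<in> set xs"
    then have x: "x \<in> A" by (rule subsetD[OF assms(1)])
    then have "{y \<in> A. r x y} \<in> classes r A" by (auto simp: classes_def quotient_def)
    moreover have "x \<in> {y \<in> A. r x y}" using x refl[OF x] by simp
    ultimately show "x \<in> \<Union>(classes r A)" by (rule UnionI)
  qed
  fix C assume "C \<in> classes r A"
  then obtain a where a: "a \<in> A" and C: "C = {x \<in> A. r a x}"
    by (auto simp: classes_def quotient_def)
  obtain x where "x \<in> set xs" "r a x" using assms(2)[OF a] by blast
  then obtain i where i: "i < length xs" "r a (xs ! i)" unfolding in_set_conv_nth by blast
  have mem: "xs ! k \<in> A" if "k < length xs" for k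
    using nth_mem[OF that] by (rule subsetD[OF assms(1)])
  have uniq: "k = l" if "k < length xs" "l < length xs" "r a (xs ! k)" "r a (xs ! l)" for k l
  proof -
    \<comment> \<open>Both directions are derived because \<open>sorted_wrt\<close> compares the
      earlier entry with the later one, and either of \<open>k\<close>, \<open>l\<close> may come
      first.\<close>
    have "r (xs ! k) a" "r (xs ! l) a" using that sym[OF a mem] by blast+
    then have "r (xs ! k) (xs ! l)" "r (xs ! l) (xs ! k)"
      using that trans[OF mem a mem] by blast+
    then have "\<not> k < l" "\<not> l < k"
      using that(1,2) sorted_wrt_nth_less[OF assms(3)] by blast+
    then show ?thesis by simp
  qed
  show "\<exists>!i. i < length xs \<and> xs ! i \<in> C"
    unfolding C using i mem uniq[OF _ i(1) _ i(2)] by (intro ex1I[of _ i]) blast+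
qed

text \<open>This handles one loop of the algorithm: blocks must be good internally and across
  different indices. It serves once for the loop over over-orders and once for the loop over weak
  representatives.\<close>

lemma sorted_wrt_concat_map:
  assumes "sorted_wrt Q xs" and "\<And>x. x \<in> set xs \<Longrightarrow> sorted_wrt P (f x)"
    and "\<And>x y a b. x \<in> set xs \<Longrightarrow> y \<in> set xs \<Longrightarrow> Q x y \<Longrightarrow> a \<in> set (f x) \<Longrightarrow> b \<in> set (f y) \<Longrightarrow> P a b"
  shows "sorted_wrt P (concat (map f xs))"
  using assms
proof (induction xs)
  case (Cons x xs)
  have "sorted_wrt P (concat (map f xs))"
  proof (rule Cons.IH)
    show "sorted_wrt Q xs" using Cons.prems(1) by simp
    show "sorted_wrt P (f y)" if "y \<in> set xs" for y using that by (intro Cons.prems(2)) simp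
    show "P a b"
      if "y \<in> set xs" "z \<in> set xs" "Q y z" "a \<in> set (f y)" "b \<in> set (f z)" for y z a b
      using that by (intro Cons.prems(3)[of y z]) simp_all
  qed
  moreover have "P a b" if a: "a \<in> set (f x)" and b: "b \<in> set (concat (map f xs))" for a b
  proof -
    obtain y where y: "y \<in> set xs" "b \<in> set (f y)" using b by auto
    moreover have "Q x y" using Cons.prems(1) y(1) by simp
    ultimately show ?thesis using a by (intro Cons.prems(3)[of x y]) simp_all
  qed
  moreover have "sorted_wrt P (f x)" by (rule Cons.prems(2)) simp
  ultimately show ?case by (simp add: sorted_wrt_append)
qed simp

section \<open>Invertible ideals and weak equivalence\<close>

lemma weakly_equivalent_refl: "weakly_equivalent I I"
  using mult_in_ideal_prod[OF one_in_colon one_in_colon, of I I] by (simp add: weakly_equivalent_def)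

text \<open>The inverse of \<open>colon I W\<close> is \<open>colon W I\<close>: their product
  multiplies \<open>I\<close> into \<open>I\<close>, hence lies in \<open>S\<close>, and it is an
  \<open>S\<close>-module containing 1.\<close>

lemma weakly_equivalent_invertible:
  assumes R: "is_order R" and I: "fractional_ideal R I" "colon I I = S"
    and W: "fractional_ideal R W" "colon W W = S" and "weakly_equivalent I W"
  shows "invertible_ideal S (colon I W)" "I = ideal_prod W (colon I W)"
proof -
  let ?L = "colon I W" and ?M = "colon W I"
  have lat: "full_lattice I" "full_lattice W"
    using R I W by (simp_all add: order_fractional_ideal_iff)
  have S: "S \<in> over_orders R" using multiplicator_ring_over_order[OF R I(1)] I(2) by simp
  have IS: "is_submodule S I" "is_submodule S W"
    using lat[THEN full_lattice_subspace, THEN colon_self_submodule] I(2) W(2) by simp_all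
  have LS: "is_submodule S ?L" "is_submodule S ?M"
    using IS by (simp_all add: colon_submodule)
  have LW: "ideal_prod ?L W \<subseteq> I" and MI: "ideal_prod ?M I \<subseteq> W"
    using subset_colon_iff[OF IS(1), of ?L W] subset_colon_iff[OF IS(2), of ?M I] by simp_all
  have LM: "ideal_prod ?L ?M = S"
  proof
    have "ideal_prod ?L (ideal_prod ?M I) \<subseteq> ideal_prod ?L W"
      using MI by (intro ideal_prod_mono) auto
    then have "ideal_prod (ideal_prod ?L ?M) I \<subseteq> I"
      using LW by (simp add: ideal_prod.assoc)
    then show "ideal_prod ?L ?M \<subseteq> S"
      using subset_colon_iff[OF IS(1)] I(2) by metis
    have 1: "1 \<in> ideal_prod ?L ?M"
      using assms(6) by (simp add: weakly_equivalent_def)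
    have "is_submodule S (ideal_prod ?L ?M)"
      using LS by (intro ideal_prod_submodule)
    then have "s * 1 \<in> ideal_prod ?L ?M" if "s \<in> S" for s
      using 1 that unfolding is_submodule_def by blast
    then show "S \<subseteq> ideal_prod ?L ?M" by auto
  qed
  show "invertible_ideal S ?L"
    unfolding invertible_ideal_def over_order_fractional_ideal_iff[OF R S]
    using LM LS full_lattice_colon[OF order_int_unit[OF R]] lat by blast
  have "1 \<in> S" using one_in_colon[of I] I(2) by simp
  \<comment> \<open>Inserting the trivial factor \<open>S\<close> and regrouping shows that
    \<open>I\<close> is contained in \<open>ideal_prod (colon I W) W\<close>.\<close>
  then have "I = ideal_prod I (ideal_prod ?L ?M)"
    using LM ideal_prod_unit[OF IS(1)] by simp
  also have "\<dots> = ideal_prod ?L (ideal_prod ?M I)" by (simp add: ideal_prod_ac)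
  also have "\<dots> \<subseteq> ideal_prod ?L W" using MI by (intro ideal_prod_mono) auto
  finally show "I = ideal_prod W ?L" using LW by (simp add: ideal_prod.commute)
qed

text \<open>Multiplying by \<open>J\<close> can only enlarge the multiplicator ring, and so can
  multiplying by \<open>J'\<close>; since both together lead back to \<open>I\<close>, all of these
  rings agree.\<close>

lemma colon_ideal_prod_invertible:
  assumes "is_submodule S I" "colon I I = S" "ideal_prod J J' = S"
  shows "colon (ideal_prod I J) (ideal_prod I J) = S"
proof
  have "1 \<in> S" using one_in_colon assms by blast
  then have "ideal_prod (ideal_prod I J) J' = I"
    using assms ideal_prod_unit by (simp add: ideal_prod.assoc)
  then show "colon (ideal_prod I J) (ideal_prod I J) \<subseteq> S"
    using colon_subset_colon_ideal_prod[of "ideal_prod I J" "ideal_prod I J" J'] assms by simp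
  show "S \<subseteq> colon (ideal_prod I J) (ideal_prod I J)"
    using colon_subset_colon_ideal_prod[of I I J] assms by simp
qed

text \<open>The crossed products \<open>J\<^sub>2 J\<^sub>1'\<close> and
  \<open>J\<^sub>1 J\<^sub>2'\<close> lie in the two colons, and their product is that of
  \<open>S\<close> with itself, which contains 1.\<close>

lemma weakly_equivalent_if_ideal_prod_eq:
  assumes I: "is_submodule S I\<^sub>1" "is_submodule S I\<^sub>2" and "1 \<in> S"
    and J: "ideal_prod J\<^sub>1 J\<^sub>1' = S" "ideal_prod J\<^sub>2 J\<^sub>2' = S"
    and eq: "ideal_prod I\<^sub>1 J\<^sub>1 = ideal_prod I\<^sub>2 J\<^sub>2"
  shows "weakly_equivalent I\<^sub>1 I\<^sub>2"
proof -
  have "ideal_prod (ideal_prod J\<^sub>2 J\<^sub>1') I\<^sub>2 = ideal_prod I\<^sub>1 (ideal_prod J\<^sub>1 J\<^sub>1')"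
    using eq by (metis ideal_prod.assoc ideal_prod.commute)
  then have "ideal_prod J\<^sub>2 J\<^sub>1' \<subseteq> colon I\<^sub>1 I\<^sub>2"
    unfolding subset_colon_iff[OF I(1)] J ideal_prod_unit[OF I(1) \<open>1 \<in> S\<close>] by simp
  moreover have "ideal_prod (ideal_prod J\<^sub>1 J\<^sub>2') I\<^sub>1 = ideal_prod I\<^sub>2 (ideal_prod J\<^sub>2 J\<^sub>2')"
    using eq by (metis ideal_prod.assoc ideal_prod.commute)
  then have "ideal_prod J\<^sub>1 J\<^sub>2' \<subseteq> colon I\<^sub>2 I\<^sub>1"
    unfolding subset_colon_iff[OF I(2)] J ideal_prod_unit[OF I(2) \<open>1 \<in> S\<close>] by simp
  moreover have "1 * 1 \<in> ideal_prod (ideal_prod J\<^sub>2 J\<^sub>1') (ideal_prod J\<^sub>1 J\<^sub>2')"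
  proof -
    have "ideal_prod (ideal_prod J\<^sub>2 J\<^sub>1') (ideal_prod J\<^sub>1 J\<^sub>2')
        = ideal_prod (ideal_prod J\<^sub>1 J\<^sub>1') (ideal_prod J\<^sub>2 J\<^sub>2')"
      by (simp add: ideal_prod_ac)
    then show ?thesis using J mult_in_ideal_prod[OF \<open>1 \<in> S\<close> \<open>1 \<in> S\<close>] by simp
  qed
  ultimately show ?thesis
    unfolding weakly_equivalent_def mult_1 by (meson ideal_prod_mono subsetD)
qed

text \<open>One half of cancelling \<open>I\<close>; equality follows by exchanging the roles of
  \<open>J\<^sub>1\<close> and \<open>J\<^sub>2\<close>.\<close>

lemma ideal_prod_cancel_subset:
  assumes I: "is_submodule S I" "colon I I = S"
    and J: "is_submodule S J\<^sub>1" "is_submodule S J\<^sub>2" "ideal_prod J\<^sub>2 J\<^sub>2' = S"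
    and eq: "ideal_prod I J\<^sub>1 = ideal_prod I J\<^sub>2"
  shows "J\<^sub>1 \<subseteq> J\<^sub>2"
proof -
  have 1: "1 \<in> S" using one_in_colon[of I] I(2) by simp
  have "ideal_prod (ideal_prod J\<^sub>1 J\<^sub>2') I = ideal_prod I (ideal_prod J\<^sub>2 J\<^sub>2')"
    using eq by (metis ideal_prod.assoc ideal_prod.commute)
  then have sub: "ideal_prod J\<^sub>1 J\<^sub>2' \<subseteq> S"
    unfolding J(3) ideal_prod_unit[OF I(1) 1] using I(2) subset_colon_iff[OF I(1), of _ I] by simp
  have "J\<^sub>1 = ideal_prod J\<^sub>1 (ideal_prod J\<^sub>2 J\<^sub>2')"
    using ideal_prod_unit[OF J(1) 1] J(3) by simp
  also have "\<dots> = ideal_prod J\<^sub>2 (ideal_prod J\<^sub>1 J\<^sub>2')" by (simp add: ideal_prod_ac)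
  also have "\<dots> \<subseteq> ideal_prod J\<^sub>2 S" using sub by (intro ideal_prod_mono) auto
  finally show ?thesis using ideal_prod_unit[OF J(2) 1] by simp
qed

text \<open>The unit \<open>a\<close> is absorbed into \<open>J\<^sub>1\<close>, which stays
  invertible, so isomorphic products become equal products and the two preceding results
  apply.\<close>

lemma module_iso_ideal_prodD:
  assumes R: "is_order R" and S: "S \<in> over_orders R"
    and I: "fractional_ideal R I\<^sub>1" "colon I\<^sub>1 I\<^sub>1 = S" "fractional_ideal R I\<^sub>2" "colon I\<^sub>2 I\<^sub>2 = S"
    and J: "invertible_ideal S J\<^sub>1" "invertible_ideal S J\<^sub>2"
    and a: "a dvd 1" "ideal_prod I\<^sub>2 J\<^sub>2 = (*) a ` ideal_prod I\<^sub>1 J\<^sub>1"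
  shows "weakly_equivalent I\<^sub>1 I\<^sub>2" "I\<^sub>1 = I\<^sub>2 \<Longrightarrow> module_iso S J\<^sub>1 J\<^sub>2"
proof -
  have lat: "full_lattice I\<^sub>1" "full_lattice I\<^sub>2"
    using R I by (simp_all add: order_fractional_ideal_iff)
  have IS: "is_submodule S I\<^sub>1" "is_submodule S I\<^sub>2"
    using lat[THEN full_lattice_subspace, THEN colon_self_submodule] I(2,4) by simp_all
  obtain J\<^sub>1' J\<^sub>2' where J': "ideal_prod J\<^sub>1 J\<^sub>1' = S" "ideal_prod J\<^sub>2 J\<^sub>2' = S"
    using J unfolding invertible_ideal_def by blast
  obtain b where b: "a * b = 1" using a(1) by (metis dvdE)
  have J1: "ideal_prod ((*) a ` J\<^sub>1) ((*) b ` J\<^sub>1') = S"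
    using ideal_prod_image_inverse[OF b] J' by metis
  have JS: "is_submodule S J\<^sub>1" "is_submodule S J\<^sub>2"
    using J unfolding invertible_ideal_def fractional_ideal_def by blast+
  have aJS: "is_submodule S ((*) a ` J\<^sub>1)"
    using JS(1) by (rule image_mult_submodule)
  have eq: "ideal_prod I\<^sub>1 ((*) a ` J\<^sub>1) = ideal_prod I\<^sub>2 J\<^sub>2"
    using a(2) by (metis ideal_prod.commute ideal_prod_image_left)
  have "1 \<in> S" using one_in_colon[of I\<^sub>1] I(2) by simp
  then show "weakly_equivalent I\<^sub>1 I\<^sub>2"
    using weakly_equivalent_if_ideal_prod_eq[OF IS _ J1 J'(2) eq] by simp
  show "module_iso S J\<^sub>1 J\<^sub>2" if "I\<^sub>1 = I\<^sub>2"
  proof -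
    have eq': "ideal_prod I\<^sub>1 ((*) a ` J\<^sub>1) = ideal_prod I\<^sub>1 J\<^sub>2" using eq that by simp
    have "(*) a ` J\<^sub>1 = J\<^sub>2"
      using ideal_prod_cancel_subset[OF IS(1) I(2) aJS JS(2) J'(2) eq']
        ideal_prod_cancel_subset[OF IS(1) I(2) JS(2) aJS J1 eq'[symmetric]] by (rule subset_antisym)
    then show ?thesis using module_isoI_unit[OF a(1), of S J\<^sub>1] by simp
  qed
qed

theorem theorem6p4:
  fixes R :: "'k::comm_ring_1 set"
    and Lo :: "'k set list"
    and Lw Li :: "'k set \<Rightarrow> 'k set list"
  assumes "is_order R"
    and "distinct Lo" and "set Lo = over_orders R"
    and "\<And>S. S \<in> set Lo \<Longrightarrow> lists_representatives (Lw S) (weak_classes R S)"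
    and "\<And>S. S \<in> set Lo \<Longrightarrow> lists_representatives (Li S) (Pic S)"
  shows "lists_representatives (icm_algorithm Lo Lw Li) (ICM R)"
proof -
  note R = assms(1)
  have Lw: "fractional_ideal R I" "colon I I = S" if "S \<in> set Lo" "I \<in> set (Lw S)" for S I
    using lists_representatives_subset[OF assms(4)[OF that(1), unfolded weak_classes_def]] that(2)
    by auto
  have Li: "invertible_ideal S J" if "S \<in> set Lo" "J \<in> set (Li S)" for S J
    using lists_representatives_subset[OF assms(5)[OF that(1), unfolded Pic_def]] that(2)
    by auto
  have Li': "fractional_ideal R J" if "S \<in> set Lo" "J \<in> set (Li S)" for S J
    using over_order_ideal_imp_ideal[OF R, of S J] Li[OF that] that(1) assms(3)
    by (simp add: invertible_ideal_def)
  have prod: "fractional_ideal R (ideal_prod I J)"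
    if "S \<in> set Lo" "I \<in> set (Lw S)" "J \<in> set (Li S)" for S I J
    using Lw(1)[OF that(1,2)] Li'[OF that(1,3)]
    by (simp add: order_fractional_ideal_iff[OF R] ideal_prod_submodule full_lattice_ideal_prod)
  have colon: "colon (ideal_prod I J) (ideal_prod I J) = S"
    if "S \<in> set Lo" "I \<in> set (Lw S)" "J \<in> set (Li S)" for S I J
  proof -
    have "is_submodule S I"
      using colon_self_submodule[of I] full_lattice_subspace[of I] Lw[OF that(1,2)]
      by (simp add: order_fractional_ideal_iff[OF R])
    moreover have "invertible_ideal S J" using Li[OF that(1,3)] .
    then obtain J' where "ideal_prod J J' = S" unfolding invertible_ideal_def by blast
    ultimately show ?thesis
      using Lw(2)[OF that(1,2)] by (intro colon_ideal_prod_invertible)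
  qed
  \<comment> \<open>With \<open>W\<close> representing the weak class of \<open>I\<close> and
    \<open>J\<close> the class of \<open>colon I W\<close>, the entry \<open>ideal_prod W J\<close>
    is a unit multiple of \<open>ideal_prod W (colon I W) = I\<close>.\<close>
  have surj: "\<exists>x\<in>set (icm_algorithm Lo Lw Li). module_iso R I x" if I: "fractional_ideal R I" for I
  proof -
    define S where "S = colon I I"
    have S: "S \<in> set Lo" using multiplicator_ring_over_order[OF R I] assms(3) by (simp add: S_def)
    obtain W where W: "W \<in> set (Lw S)" "weakly_equivalent I W"
      using lists_representatives_ex[OF assms(4)[OF S, unfolded weak_classes_def], of I] I S_def
      by auto
    note L = weakly_equivalent_invertible[OF R I S_def[symmetric] Lw[OF S W(1)] W(2)]
    obtain J where J: "J \<in> set (Li S)" "module_iso S (colon I W) J"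
      using lists_representatives_ex[OF assms(5)[OF S, unfolded Pic_def]] L(1) by auto
    have "module_iso R (colon I W) J"
      using over_order_superset[of S R] S assms(3) J(2) by (intro module_iso_subring[of R S]) simp_all
    moreover have "fractional_ideal R (colon I W)"
      using over_order_ideal_imp_ideal[OF R, of S] L(1) S assms(3)
      by (simp add: invertible_ideal_def)
    ultimately obtain a where a: "a dvd 1" "J = (*) a ` colon I W"
      using module_isoD_unit[OF R _ Li'[OF S J(1)]] by blast
    have "ideal_prod W J = (*) a ` I"
      using a(2) L(2) by (metis ideal_prod.commute ideal_prod_image_left)
    then have "module_iso R I (ideal_prod W J)" using module_isoI_unit[OF a(1)] by metis
    then show ?thesis using S W(1) J(1) by (auto simp: icm_algorithm_def)
  qed
  have colon_iso: "colon x x = colon y y"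
    if "fractional_ideal R x" "fractional_ideal R y" "module_iso R x y" for x y
    using module_isoD_unit[OF R that] by (auto simp: colon_image_unit)
  have same: "weakly_equivalent I\<^sub>1 I\<^sub>2 \<and> (I\<^sub>1 = I\<^sub>2 \<longrightarrow> module_iso S J\<^sub>1 J\<^sub>2)"
    if S: "S \<in> set Lo" and I: "I\<^sub>1 \<in> set (Lw S)" "I\<^sub>2 \<in> set (Lw S)"
      and J: "J\<^sub>1 \<in> set (Li S)" "J\<^sub>2 \<in> set (Li S)"
      and iso: "module_iso R (ideal_prod I\<^sub>1 J\<^sub>1) (ideal_prod I\<^sub>2 J\<^sub>2)" for S I\<^sub>1 I\<^sub>2 J\<^sub>1 J\<^sub>2
  proof -
    obtain a where a: "a dvd 1" "ideal_prod I\<^sub>2 J\<^sub>2 = (*) a ` ideal_prod I\<^sub>1 J\<^sub>1"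
      using module_isoD_unit[OF R prod[OF S I(1) J(1)] prod[OF S I(2) J(2)] iso] by blast
    then show ?thesis
      using module_iso_ideal_prodD[OF R _ Lw[OF S I(1)] Lw[OF S I(2)] Li[OF S J(1)] Li[OF S J(2)]]
        a S assms(3) by simp
  qed
  \<comment> \<open>Pairwise non-isomorphism follows the nesting of the loops: over-orders are told
    apart by multiplicator rings, then the first factors by weak equivalence, then the second
    factors by their class in \<open>Pic S\<close>.\<close>
  let ?unrelated = "\<lambda>x y. \<not> module_iso R x y"
  let ?step = "\<lambda>S. concat (map (\<lambda>I. map (ideal_prod I) (Li S)) (Lw S))"
  have step: "sorted_wrt ?unrelated (?step S)" if S: "S \<in> set Lo" for S
  proof (rule sorted_wrt_concat_map)
    show "sorted_wrt (\<lambda>x y. \<not> weakly_equivalent x y) (Lw S)"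
      using assms(4)[OF S] weakly_equivalent_refl unfolding weak_classes_def
      by (rule lists_representatives_unrelated)
    show "sorted_wrt ?unrelated (map (ideal_prod I) (Li S))" if "I \<in> set (Lw S)" for I
    proof -
      have "sorted_wrt (\<lambda>x y. \<not> module_iso S x y) (Li S)"
        using assms(5)[OF S] module_iso_refl unfolding Pic_def
        by (rule lists_representatives_unrelated)
      then show ?thesis
        unfolding sorted_wrt_map
        \<comment> \<open>The first factor is common here, so an isomorphism of products would
          descend to the second factors.\<close>
        by (rule sorted_wrt_mono_rel[rotated]) (use same[OF S that that] in blast)
    qed
    fix I\<^sub>1 I\<^sub>2 x y
    assume I: "I\<^sub>1 \<in> set (Lw S)" "I\<^sub>2 \<in> set (Lw S)" "\<not> weakly_equivalent I\<^sub>1 I\<^sub>2"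
      and "x \<in> set (map (ideal_prod I\<^sub>1) (Li S))" "y \<in> set (map (ideal_prod I\<^sub>2) (Li S))"
    then obtain J\<^sub>1 J\<^sub>2 where "J\<^sub>1 \<in> set (Li S)" "J\<^sub>2 \<in> set (Li S)"
      and "x = ideal_prod I\<^sub>1 J\<^sub>1" "y = ideal_prod I\<^sub>2 J\<^sub>2" by auto
    then show "\<not> module_iso R x y" using same[OF S I(1,2)] I(3) by blast
  qed
  have "sorted_wrt (\<noteq>) xs" if "distinct xs" for xs :: "'k set list"
    using that by (induction xs) auto
  from this[OF assms(2)] have "sorted_wrt ?unrelated (concat (map ?step Lo))"
  proof (rule sorted_wrt_concat_map[OF _ step])
    fix S T x y
    assume ST: "S \<in> set Lo" "T \<in> set Lo" "S \<noteq> T" and "x \<in> set (?step S)" "y \<in> set (?step T)"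
    then have "fractional_ideal R x" "colon x x = S" "fractional_ideal R y" "colon y y = T"
      using prod colon by auto
    then show "\<not> module_iso R x y" using colon_iso ST(3) by blast
  qed
  then have "sorted_wrt ?unrelated (icm_algorithm Lo Lw Li)"
    by (simp add: icm_algorithm_def)
  moreover have "set (icm_algorithm Lo Lw Li) \<subseteq> {I. fractional_ideal R I}"
    using prod by (auto simp: icm_algorithm_def)
  ultimately show ?thesis
    unfolding ICM_def
    by (intro lists_representativesI)
      (auto intro: surj module_iso_refl module_iso_sym[OF R] module_iso_trans[OF R])
qed

end
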